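(* Let $\mathbb{F}$ be a field, let $n\geq 2$, let $y\in\mathbb{F}$ and let $x\in\mathbb{F}^{\times}$ with $x\notin\{1,-1\}$. Put $z=\frac{yx}{x^2-1}$. Then, as $n\times n$ matrices over $\mathbb{F}$, $$Q(y,x)=P_1(z)\,D(x^2)\,P_1(-z).$$
   Context: All matrices are $n\times n$ with indices $1\le i,j\le n$, and the convention $0^0=1$ is used. For $w\in\mathbb{F}$, the generalized Pascal matrix of the first kind $P_1(w)$ has $(i,j)$ entry $w^{j-i}\binom{j-1}{i-1}$ if $j\geq i$ and $0$ otherwise. For $y\in\mathbb{F}$, $x\in\mathbb{F}^{\times}$, the Zhang–Liu matrix $Q(y,x)$ has $(i,j)$ entry $y^{j-i}x^{j+i-2}\binom{j-1}{i-1}$ if $j\geq i$ and $0$ otherwise. For $\alpha\in\mathbb{F}$, $D(\alpha)$ is the diagonal matrix with diagonal entries $D(\alpha)_{i,i}=\alpha^{i-1}$. *)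

theory Defs
  imports "Jordan_Normal_Form.Matrix"
begin

text \<open>
  Matrices in \<^typ>\<open>'a mat\<close> are indexed from 0, so the mathematical entry \<open>(i, j)\<close> with
  \<open>1 \<le> i, j \<le> n\<close> is the entry \<open>(i - 1, j - 1)\<close> below. In particular \<open>j + i - 2\<close> becomes
  \<open>j + i\<close>, \<open>j - i\<close> is unchanged (and only used for \<open>i \<le> j\<close>), and the binomial
  coefficient of \<open>j - 1\<close> over \<open>i - 1\<close> becomes \<open>j choose i\<close>.
\<close>

definition pascal_P1 :: "nat \<Rightarrow> 'a::field \<Rightarrow> 'a mat" where
  "pascal_P1 n w =
     mat n n (\<lambda>(i, j). if i \<le> j then w ^ (j - i) * of_nat (j choose i) else 0)"

definition zhang_liu_Q :: "nat \<Rightarrow> 'a::field \<Rightarrow> 'a \<Rightarrow> 'a mat" where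
  "zhang_liu_Q n y x =
     mat n n (\<lambda>(i, j). if i \<le> j then y ^ (j - i) * x ^ (j + i) * of_nat (j choose i) else 0)"

definition diag_D :: "nat \<Rightarrow> 'a::field \<Rightarrow> 'a mat" where
  "diag_D n \<alpha> = mat n n (\<lambda>(i, j). if i = j then \<alpha> ^ i else 0)"

end

theory Submission
  imports Defs
begin

text \<open>
  Absorbing \<open>(j choose k) (k choose i) = (j choose i) (j - i choose k - i)\<close>, the entry of
  \<open>P\<^sub>1(w) D(a) P\<^sub>1(v)\<close> at \<open>(i, j)\<close> becomes a binomial expansion of \<open>(w a + v)\<close> to the power
  \<open>j - i\<close>. For \<open>w = z\<close>, \<open>v = -z\<close> and \<open>a = x\<^sup>2\<close> its base is \<open>z (x\<^sup>2 - 1) = y x\<close>.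
\<close>

lemma pascal_convolution:
  fixes w a v :: "'a::comm_semiring_1"
  assumes "i \<le> j"
  shows "(\<Sum>k=i..j. w ^ (k - i) * of_nat (k choose i) * a ^ k * (v ^ (j - k) * of_nat (j choose k)))
    = a ^ i * (w * a + v) ^ (j - i) * of_nat (j choose i)"
proof -
  \<comment> \<open>With \<open>k = m + i\<close> the exponent \<open>k - i\<close> is just
    \<open>m\<close>, and each summand is a fixed factor times a term of the binomial
    expansion.\<close>
  have term_eq: "w ^ m * of_nat ((m + i) choose i) * a ^ (m + i)
        * (v ^ (j - (m + i)) * of_nat (j choose (m + i)))
      = a ^ i * of_nat (j choose i) * (of_nat ((j - i) choose m) * (w * a) ^ m * v ^ (j - i - m))"
    if "m \<le> j - i" for m
  proof -
    have "(j choose (m + i)) * ((m + i) choose i) = (j choose i) * ((j - i) choose m)"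
      using choose_mult[of i "m + i" j] that assms by simp
    \<comment> \<open>The identity is proved in the naturals and then cast; nothing is divided, so
      the characteristic does not matter.\<close>
    then have "(of_nat (j choose (m + i)) * of_nat ((m + i) choose i) :: 'a)
        = of_nat (j choose i) * of_nat ((j - i) choose m)"
      by (metis of_nat_mult)
    then have "w ^ m * a ^ (m + i) * v ^ (j - (m + i))
          * (of_nat (j choose (m + i)) * of_nat ((m + i) choose i))
        = w ^ m * a ^ (m + i) * v ^ (j - i - m) * (of_nat (j choose i) * of_nat ((j - i) choose m))"
      by (simp add: add.commute)
    then show ?thesis
      by (simp only: power_add power_mult_distrib mult_ac)
  qed
  \<comment> \<open>Both bounds are written as \<open>_ + i\<close> to fit the index-shift
    rule.\<close>
  have "{i..j} = {0 + i..(j - i) + i}" using assms by simp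
  then have "(\<Sum>k=i..j. w ^ (k - i) * of_nat (k choose i) * a ^ k * (v ^ (j - k) * of_nat (j choose k)))
    = (\<Sum>m\<le>j - i. w ^ m * of_nat ((m + i) choose i) * a ^ (m + i)
        * (v ^ (j - (m + i)) * of_nat (j choose (m + i))))"
    by (simp only: sum.shift_bounds_cl_nat_ivl) (simp add: atMost_atLeast0)
  also have "\<dots> = a ^ i * of_nat (j choose i) * (w * a + v) ^ (j - i)"
    by (simp add: term_eq binomial_ring sum_distrib_left)
  finally show ?thesis by (simp add: mult_ac)
qed

lemma pascal_diag_pascal:
  "pascal_P1 n w * diag_D n a * pascal_P1 n v =
    mat n n (\<lambda>(i, j). if i \<le> j then a ^ i * (w * a + v) ^ (j - i) * of_nat (j choose i) else 0)"
  (is "_ = ?R")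
proof (rule eq_matI)
  fix i j assume "i < dim_row ?R" "j < dim_col ?R"
  then have ij: "i < n" "j < n" by simp_all
  \<comment> \<open>The diagonal factor leaves one term of the inner sum: column \<open>k\<close> is
    scaled by \<open>a ^ k\<close>.\<close>
  have PD: "(pascal_P1 n w * diag_D n a) $$ (i, k) =
      (if i \<le> k then w ^ (k - i) * of_nat (k choose i) * a ^ k else 0)"
    if "k < n" for k
    using that ij by (simp add: pascal_P1_def diag_D_def scalar_prod_def if_distrib[of "(*) c" for c] cong: if_cong)
  have P: "pascal_P1 n v $$ (k, j) = (if k \<le> j then v ^ (j - k) * of_nat (j choose k) else 0)"
    if "k < n" for k
    using that ij by (simp add: pascal_P1_def)
  have "(pascal_P1 n w * diag_D n a * pascal_P1 n v) $$ (i, j) =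
      (\<Sum>k<n. (pascal_P1 n w * diag_D n a) $$ (i, k) * pascal_P1 n v $$ (k, j))"
    using ij by (simp add: pascal_P1_def diag_D_def scalar_prod_def lessThan_atLeast0)
  also have "\<dots> = (\<Sum>k=i..j. w ^ (k - i) * of_nat (k choose i) * a ^ k * (v ^ (j - k) * of_nat (j choose k)))"
    using ij by (intro sum.mono_neutral_cong_right) (auto simp: PD P)
  finally show "(pascal_P1 n w * diag_D n a * pascal_P1 n v) $$ (i, j) = ?R $$ (i, j)"
    using ij by (simp add: pascal_convolution)
qed (simp_all add: pascal_P1_def)

theorem theorem1:
  fixes x y z :: "'a::field" and n :: nat
  assumes "n \<ge> 2"
    and "x \<noteq> 0"
    and "x \<notin> {1, -1}"
    and "z = (y * x) / (x ^ 2 - 1)"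
  shows "zhang_liu_Q n y x = pascal_P1 n z * diag_D n (x ^ 2) * pascal_P1 n (- z)"
proof -
  have "x ^ 2 - 1 \<noteq> 0"
    using assms(3) by (simp add: power2_eq_1_iff)
  then have base: "z * x ^ 2 + - z = y * x"
    using assms(4) by (simp add: field_simps)
  have "y ^ (j - i) * x ^ (j + i) = (x ^ 2) ^ i * (y * x) ^ (j - i)" if "i \<le> j" for i j
  proof -
    \<comment> \<open>The even part \<open>2 * i\<close> supplies the power of \<open>x ^ 2\<close>;
      the remaining \<open>j - i\<close> factors \<open>x\<close> pair with those of
      \<open>y\<close>.\<close>
    have "j + i = 2 * i + (j - i)" using that by simp
    then have "x ^ (j + i) = (x ^ 2) ^ i * x ^ (j - i)" by (metis power_add power_mult)
    then show ?thesis by (simp add: power_mult_distrib mult_ac)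
  qed
  then show ?thesis
    unfolding pascal_diag_pascal base zhang_liu_Q_def by (intro cong_mat) auto
qed

end
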